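(* Let $n,a,b\geq 1$ be integers with $n\geq 5$, and let $V_1,V_2$ be disjoint sets with $|V_1|=an$ and $|V_2|=bn$. Let $\mathcal{H}\subseteq\binom{V_1}{a}\sqcup\binom{V_2}{b}$. If there exists $\alpha\in(0,1)$ such that \[ \delta_a(\mathcal{H})\geq\Big(\alpha+4\sqrt{\log n/n}\Big)\binom{bn}{b} \quad\text{and}\quad \delta_b(\mathcal{H})\geq\Big(1-\alpha+4\sqrt{\log n/n}\Big)\binom{an}{a}, \] then $\mathcal{H}$ contains a Hamilton $(a,b)$-cycle.
   Context: $\binom{V_1}{a}\sqcup\binom{V_2}{b}$ denotes the family of all subsets $F\subseteq V_1\cup V_2$ with $|F\cap V_1|=a$ and $|F\cap V_2|=b$; $\mathcal{H}$ is regarded as an $(a+b)$-uniform hypergraph with vertex set $V_1\cup V_2$. Here $\delta_a(\mathcal{H})$ is the minimum, over all $a$-subsets $A\subseteq V_1$, of the number of edges of $\mathcal{H}$ containing $A$, and $\delta_b(\mathcal{H})$ is the minimum, over all $b$-subsets $B\subseteq V_2$, of the number of edges of $\mathcal{H}$ containing $B$. With $k=a+b$, a $k$-uniform hypergraph is an $(a,b)$-cycle if there is a partition $(A_0,B_0,A_1,B_1,\dots,A_{t-1},B_{t-1})$ of its vertex set with $|A_i|=a$, $|B_i|=b$ such that $A_i\cup B_i$ and $B_i\cup A_{i+1}$ (indices modulo $t$) are edges for all $i=0,\dots,t-1$. $\mathcal{H}$ contains a Hamilton $(a,b)$-cycle if some subhypergraph of $\mathcal{H}$ is an $(a,b)$-cycle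 covering all vertices $V_1\cup V_2$. *)

theory Defs
  imports "HOL-Analysis.Analysis"
begin

definition bipartite_family :: "'v set \<Rightarrow> 'v set \<Rightarrow> nat \<Rightarrow> nat \<Rightarrow> 'v set set" where
  "bipartite_family V1 V2 a b =
     {F. F \<subseteq> V1 \<union> V2 \<and> card (F \<inter> V1) = a \<and> card (F \<inter> V2) = b}"

definition hdeg :: "'v set set \<Rightarrow> 'v set \<Rightarrow> nat" where
  "hdeg H S = card {e \<in> H. S \<subseteq> e}"

definition min_deg :: "'v set set \<Rightarrow> 'v set \<Rightarrow> nat \<Rightarrow> nat" where
  "min_deg H V k = Min ((\<lambda>S. hdeg H S) ` {S. S \<subseteq> V \<and> card S = k})"

definition has_hamilton_ab_cycle :: "'v set set \<Rightarrow> 'v set \<Rightarrow> nat \<Rightarrow> nat \<Rightarrow> bool" where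
  "has_hamilton_ab_cycle H W a b \<longleftrightarrow>
     (\<exists>t::nat. \<exists>A B :: nat \<Rightarrow> 'v set. t \<ge> 1 \<and>
        (\<forall>i<t. card (A i) = a \<and> card (B i) = b) \<and>
        (\<forall>i<t. \<forall>j<t. A i \<inter> B j = {}) \<and>
        (\<forall>i<t. \<forall>j<t. i \<noteq> j \<longrightarrow> A i \<inter> A j = {} \<and> B i \<inter> B j = {}) \<and>
        (\<Union>i<t. A i \<union> B i) = W \<and>
        (\<forall>i<t. A i \<union> B i \<in> H \<and> B i \<union> A ((i + 1) mod t) \<in> H))"

end

theory Submission
  imports Defs "HOL-Combinatorics.Permutations" "HOL-Number_Theory.Cong"
begin

text \<open>
  Cut \<open>V1\<close> and \<open>V2\<close> into \<open>n\<close> random blocks of sizes \<open>a\<close> and \<open>b\<close> and join two blocks when their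
  union is an edge. If every degree on one side exceeds \<open>\<alpha> n\<close> and every degree on the other
  exceeds \<open>(1 - \<alpha>) n\<close>, this bipartite graph is Hamiltonian by the theorem of Moon and Moser.

  The degrees concentrate with bounds independent of the block size. For \<open>h \<ge> 0\<close>, replacing \<open>h\<close>
  by its average over a transposition of the ground set does not decrease the expectation of
  \<open>\<Prod>\<^sub>j sqrt (h B\<^sub>j)\<close> over a random partition \<open>(B\<^sub>j)\<close>, because a transposition changes at most two
  blocks and Cauchy-Schwarz applies to these. Averaging down to a constant bounds the expectation
  by \<open>sqrt (mean h)\<close> raised to the number of blocks. Taking \<open>h = exp (2 \<epsilon> 1\<^sub>P)\<close> for the family \<open>P\<close> of
  non-neighbours gives a Chernoff bound for the number of non-neighbours of a block.
\<close>

subsection \<open>Hamilton cycles in bipartite graphs\<close>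

text \<open>The closed walk \<open>u 0, v 0, u 1, v 1, ...\<close>, where \<open>v i\<close> lies
  between \<open>u i\<close> and its cyclic successor. That every vertex occurs exactly once is
  expressed separately, by bijectivity of \<open>u\<close> and \<open>v\<close>.\<close>

definition ham_cycle :: "nat \<Rightarrow> ('a \<Rightarrow> 'b \<Rightarrow> bool) \<Rightarrow> (nat \<Rightarrow> 'a) \<Rightarrow> (nat \<Rightarrow> 'b) \<Rightarrow> bool" where
  "ham_cycle n R u v \<longleftrightarrow> (\<forall>i<n. R (u i) (v i) \<and> R (u (Suc i mod n)) (v i))"

lemma bij_betw_rotate: "bij_betw (\<lambda>i. (i + c) mod n) {..<n} {..<(n::nat)}"
proof -
  have "inj_on (\<lambda>i. (i + c) mod n) {..<n}"
  proof (rule inj_onI)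
    fix i j assume "i \<in> {..<n}" "j \<in> {..<n}" "(i + c) mod n = (j + c) mod n"
    then have "[i + c = j + c] (mod n)" "i < n" "j < n"
      by (auto simp: cong_def)
    then show "i = j"
      by (meson cong_add_rcancel_nat cong_less_modulus_unique_nat)
  qed
  moreover have "(\<lambda>i. (i + c) mod n) ` {..<n} \<subseteq> {..<n}"
    by auto
  ultimately show ?thesis
    by (metis bij_betw_def endo_inj_surj finite_lessThan)
qed

lemma ham_cycle_rotate:
  assumes "bij_betw u {..<n} X" "bij_betw v {..<n} Y" "ham_cycle n R u v"
  shows "bij_betw (\<lambda>i. u ((i + c) mod n)) {..<n} X"
    and "bij_betw (\<lambda>i. v ((i + c) mod n)) {..<n} Y"
    and "ham_cycle n R (\<lambda>i. u ((i + c) mod n)) (\<lambda>i. v ((i + c) mod n))"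
proof -
  show "bij_betw (\<lambda>i. u ((i + c) mod n)) {..<n} X" "bij_betw (\<lambda>i. v ((i + c) mod n)) {..<n} Y"
    using bij_betw_trans[OF bij_betw_rotate assms(1)] bij_betw_trans[OF bij_betw_rotate assms(2)]
    by (simp_all add: comp_def)
  show "ham_cycle n R (\<lambda>i. u ((i + c) mod n)) (\<lambda>i. v ((i + c) mod n))"
    unfolding ham_cycle_def
  proof (intro allI impI)
    fix i assume "i < n"
    then have "(i + c) mod n < n" by simp
    moreover have "(Suc i mod n + c) mod n = Suc ((i + c) mod n) mod n"
      by (simp add: mod_simps)
    ultimately show "R (u ((i + c) mod n)) (v ((i + c) mod n)) \<and>
        R (u ((Suc i mod n + c) mod n)) (v ((i + c) mod n))"
      using assms(3) by (simp add: ham_cycle_def)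
  qed
qed

text \<open>Induction on the number of non-adjacent pairs: adding an edge keeps the degree
  condition, and a complete bipartite graph is Hamiltonian. If the cycle found after adding the edge
  \<open>x y\<close> uses it, the rest is a Hamilton path between \<open>x\<close> and
  \<open>y\<close>, and their degree sum provides two chords that close it up differently.\<close>

lemma moon_moser:
  fixes R :: "'a \<Rightarrow> 'b \<Rightarrow> bool"
  assumes "finite X" "finite Y" "card X = n" "card Y = n" "n > 0"
    and deg: "\<And>x y. x \<in> X \<Longrightarrow> y \<in> Y \<Longrightarrow> card {y \<in> Y. R x y} + card {x \<in> X. R x y} > n"
  shows "\<exists>u v. bij_betw u {..<n} X \<and> bij_betw v {..<n} Y \<and> ham_cycle n R u v"
  using deg
proof (induction "card {(x, y) \<in> X \<times> Y. \<not> R x y}" arbitrary: R rule: less_induct)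
  case (less R)
  show ?case
  proof (cases "\<forall>x\<in>X. \<forall>y\<in>Y. R x y")
    case True
    obtain u v where uv: "bij_betw u {..<n} X" "bij_betw v {..<n} Y"
      using assms(1-4) ex_bij_betw_nat_finite by (metis lessThan_atLeast0)
    have "u i \<in> X" "v i \<in> Y" if "i < n" for i
      using uv that by (auto simp: bij_betw_def)
    then have "ham_cycle n R u v"
      using True \<open>n > 0\<close> by (auto simp: ham_cycle_def)
    then show ?thesis using uv by blast
  next
    case False
    then obtain x y where xy: "x \<in> X" "y \<in> Y" "\<not> R x y" by blast
    define R' where "R' = (\<lambda>x' y'. R x' y' \<or> x' = x \<and> y' = y)"
    have "{(x, y) \<in> X \<times> Y. \<not> R' x y} \<subset> {(x, y) \<in> X \<times> Y. \<not> R x y}"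
      using xy by (auto simp: R'_def)
    then have "card {(x, y) \<in> X \<times> Y. \<not> R' x y} < card {(x, y) \<in> X \<times> Y. \<not> R x y}"
      by (intro psubset_card_mono)
        (auto intro: finite_subset[OF _ finite_cartesian_product[OF assms(1,2)]])
    moreover have "card {y \<in> Y. R' x y} + card {x \<in> X. R' x y} > n" if "x \<in> X" "y \<in> Y" for x y
    proof -
      have "card {y \<in> Y. R x y} \<le> card {y \<in> Y. R' x y}"
           "card {x \<in> X. R x y} \<le> card {x \<in> X. R' x y}"
        by (intro card_mono; use assms(1,2) in \<open>auto simp: R'_def\<close>)+
      then show ?thesis using less.prems[OF that] by linarith
    qed
    ultimately obtain u v where u: "bij_betw u {..<n} X" and v: "bij_betw v {..<n} Y"
      and ham: "ham_cycle n R' u v"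
      using less.hyps by blast
    show ?thesis
    proof (cases "ham_cycle n R u v")
      case True
      then show ?thesis using u v by blast
    next
      case False
      \<comment> \<open>Normalisation: the added edge becomes the closing edge, from
        \<open>v (n - 1)\<close> back to \<open>u 0\<close>.\<close>
      have "\<exists>u v. bij_betw u {..<n} X \<and> bij_betw v {..<n} Y \<and> ham_cycle n R' u v \<and>
        u 0 = x \<and> v (n - 1) = y"
      proof -
        consider k where "k < n" "u k = x" "v k = y"
          | k where "k < n" "u (Suc k mod n) = x" "v k = y"
          using False ham unfolding ham_cycle_def R'_def by blast
        then show ?thesis
        proof cases
          case 1
          define u' v' where "u' = (\<lambda>i. u ((i + k) mod n))" and "v' = (\<lambda>i. v ((i + k) mod n))"
          note r = ham_cycle_rotate[OF u v ham, of k, folded u'_def v'_def]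
          \<comment> \<open>After the rotation the added edge is the pair at index 0. Traversing
            backwards exchanges the two edge types: \<open>f\<close> reverses the
            \<open>u\<close>-indices with 0 fixed, and \<open>g\<close> reverses all
            \<open>v\<close>-indices, so \<open>v' 0\<close> moves to position
            \<open>n - 1\<close>.\<close>
          define f g where "f = (\<lambda>i. if i = 0 then 0 else n - i)" and "g = (\<lambda>i. n - Suc i)"
          have "inj_on f {..<n}" "inj_on g {..<n}"
            by (auto simp: f_def g_def inj_on_def split: if_splits)
          moreover have "f ` {..<n} \<subseteq> {..<n}" "g ` {..<n} \<subseteq> {..<n}"
            using \<open>n > 0\<close> by (auto simp: f_def g_def)
          ultimately have "bij_betw f {..<n} {..<n}" "bij_betw g {..<n} {..<n}"
            unfolding bij_betw_def by (metis endo_inj_surj finite_lessThan)+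
          then have bij: "bij_betw (u' \<circ> f) {..<n} X" "bij_betw (v' \<circ> g) {..<n} Y"
            using r bij_betw_trans by blast+
          have "ham_cycle n R' (u' \<circ> f) (v' \<circ> g)"
            unfolding ham_cycle_def
          proof (intro allI impI)
            fix i assume "i < n"
            then have "g i < n" "f i = Suc (g i) mod n" "f (Suc i mod n) = g i"
              by (auto simp: f_def g_def Suc_diff_Suc mod_Suc)
            then show "R' ((u' \<circ> f) i) ((v' \<circ> g) i) \<and> R' ((u' \<circ> f) (Suc i mod n)) ((v' \<circ> g) i)"
              using r(3) unfolding ham_cycle_def by simp
          qed
          moreover have "(u' \<circ> f) 0 = x" "(v' \<circ> g) (n - 1) = y"
            using 1 by (simp_all add: u'_def v'_def f_def g_def)
          ultimately show ?thesis using bij by blast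
        next
          case 2
          note r = ham_cycle_rotate[OF u v ham, of "Suc k"]
          have "(n - 1 + Suc k) mod n = k" using 2 by simp
          then show ?thesis using r 2 by (intro exI conjI) (rule r, rule r, rule r, simp_all)
        qed
      qed
      then obtain u v where u: "bij_betw u {..<n} X" and v: "bij_betw v {..<n} Y"
        and ham: "ham_cycle n R' u v" and ends: "u 0 = x" "v (n - 1) = y" by blast
      have u_inj: "i = j" if "u i = u j" "i < n" "j < n" for i j
        using u that by (auto simp: bij_betw_def inj_on_def)
      have v_inj: "i = j" if "v i = v j" "i < n" "j < n" for i j
        using v that by (auto simp: bij_betw_def inj_on_def)
      \<comment> \<open>\<open>R'\<close> and \<open>R\<close> differ only at \<open>(x, y)\<close>,
        whose indices are \<open>0\<close> and \<open>n - 1\<close>. For \<open>n > 1\<close> these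
        are distinct, so no pair \<open>u i\<close>, \<open>v i\<close> is the added edge.\<close>
      have R1: "R (u i) (v i)" if "i < n" "n > 1" for i
      proof -
        have "\<not> (u i = x \<and> v i = y)"
        proof
          assume "u i = x \<and> v i = y"
          then have "u i = u 0" "v i = v (n - 1)" using ends by simp_all
          then have "i = 0" "i = n - 1" using u_inj[of i 0] v_inj[of i "n - 1"] that by linarith+
          then show False using \<open>n > 1\<close> by simp
        qed
        then show ?thesis using ham that unfolding ham_cycle_def R'_def by blast
      qed
      have R2: "R (u (Suc i)) (v i)" if "Suc i < n" for i
      proof -
        have "R' (u (Suc i mod n)) (v i)"
          using ham that unfolding ham_cycle_def by (meson Suc_lessD)
        moreover have "u (Suc i) \<noteq> x"
          using u_inj[of "Suc i" 0] ends(1) that by (metis nat.simps(3) not_less_zero not_gr_zero)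
        ultimately show ?thesis
          using that by (simp add: R'_def)
      qed
      have "card {i\<in>{..<n}. R x (v i)} = card {y \<in> Y. R x y}"
        by (rule bij_betw_same_card[of v]) (use v in \<open>auto simp: bij_betw_def inj_on_def\<close>)
      moreover have "card {i\<in>{..<n}. R (u i) y} = card {x \<in> X. R x y}"
        by (rule bij_betw_same_card[of u]) (use u in \<open>auto simp: bij_betw_def inj_on_def\<close>)
      ultimately have gt: "card {i\<in>{..<n}. R x (v i)} + card {i\<in>{..<n}. R (u i) y} > n"
        using less.prems[OF xy(1,2)] by simp
      \<comment> \<open>Pigeonhole: two subsets of \<open>{..<n}\<close> whose sizes add up to more
        than \<open>n\<close> share an index \<open>i\<close>, so \<open>x\<close> is joined to
        \<open>v i\<close> and \<open>y\<close> to \<open>u i\<close>.\<close>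
      have "{i\<in>{..<n}. R x (v i)} \<inter> {i\<in>{..<n}. R (u i) y} \<noteq> {}"
      proof
        assume "{i\<in>{..<n}. R x (v i)} \<inter> {i\<in>{..<n}. R (u i) y} = {}"
        then have "card {i\<in>{..<n}. R x (v i)} + card {i\<in>{..<n}. R (u i) y} =
            card ({i\<in>{..<n}. R x (v i)} \<union> {i\<in>{..<n}. R (u i) y})"
          by (subst card_Un_disjoint) auto
        also have "\<dots> \<le> card {..<n}" by (rule card_mono) auto
        finally show False using gt by simp
      qed
      then obtain i where i: "i < n" "R x (v i)" "R (u i) y" by blast
      \<comment> \<open>For \<open>n = 1\<close> the chord from \<open>x\<close> to
        \<open>v i\<close> would be the missing edge \<open>x y\<close> itself.\<close>
      have "n > 1"
        using i xy ends by (metis One_nat_def diff_Suc_1' less_one less_Suc_eq nat_neq_iff not_less_eq)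
      \<comment> \<open>The new cycle is \<open>a\<^sub>i b\<^sub>i\<^sub>-\<^sub>1 a\<^sub>i\<^sub>-\<^sub>1 \<dots> b\<^sub>0 a\<^sub>0 b\<^sub>i a\<^sub>i\<^sub>+\<^sub>1 \<dots> b\<^sub>n\<^sub>-\<^sub>1\<close>, with \<open>a = u\<close> and \<open>b = v\<close>.\<close>
      define f g where "f = (\<lambda>j. if j \<le> i then i - j else j)" and "g = (\<lambda>j. if j < i then i - 1 - j else j)"
      have "inj_on f {..<n}" "inj_on g {..<n}"
        by (auto simp: f_def g_def inj_on_def split: if_splits)
      moreover have "f ` {..<n} \<subseteq> {..<n}" "g ` {..<n} \<subseteq> {..<n}"
        using i by (auto simp: f_def g_def)
      ultimately have "bij_betw f {..<n} {..<n}" "bij_betw g {..<n} {..<n}"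
        unfolding bij_betw_def by (metis endo_inj_surj finite_lessThan)+
      then have bij: "bij_betw (u \<circ> f) {..<n} X" "bij_betw (v \<circ> g) {..<n} Y"
        using u v bij_betw_trans by blast+
      have "ham_cycle n R (u \<circ> f) (v \<circ> g)"
        unfolding ham_cycle_def
      proof (intro allI impI conjI)
        fix j assume "j < n"
        show "R ((u \<circ> f) j) ((v \<circ> g) j)"
        proof (cases "j < i")
          case True
          then show ?thesis using R2[of "i - 1 - j"] i(1) by (simp add: f_def g_def Suc_diff_Suc)
        next
          case False
          then show ?thesis using R1[of j] i ends \<open>j < n\<close> \<open>n > 1\<close> by (auto simp: f_def g_def)
        qed
        \<comment> \<open>At \<open>j = n - 1\<close> this is the chord from \<open>y\<close> to
          \<open>u i\<close>; the chord from \<open>x\<close> to \<open>v i\<close> was the pair at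
          \<open>j = i\<close> in the other half.\<close>
        show "R ((u \<circ> f) (Suc j mod n)) ((v \<circ> g) j)"
        proof (cases "Suc j = n")
          case True
          then have "n - 1 = j" "\<not> j < i" using i(1) by auto
          then show ?thesis using True i ends by (simp add: f_def g_def)
        next
          case False
          then show ?thesis using R1[of "i - 1 - j"] R2[of j] \<open>j < n\<close> \<open>n > 1\<close> i(1)
            by (auto simp: f_def g_def)
        qed
      qed
      then show ?thesis using bij by blast
    qed
  qed
qed

subsection \<open>Symmetrization over random partitions\<close>

text \<open>This is \<open>fact (card V)\<close> times an expectation over a uniformly random
  permutation; the images of the fixed blocks \<open>D j\<close> play the role of the random
  blocks.\<close>

definition perm_sum :: "'v set \<Rightarrow> 'i set \<Rightarrow> ('i \<Rightarrow> 'v set) \<Rightarrow> ('v set \<Rightarrow> real) \<Rightarrow> real" where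
  "perm_sum V I D h = (\<Sum>\<pi> | \<pi> permutes V. \<Prod>j\<in>I. sqrt (h (\<pi> ` D j)))"

text \<open>Cauchy-Schwarz for the vectors \<open>(sqrt a, sqrt c)\<close> and
  \<open>(sqrt b, sqrt d)\<close>.\<close>

lemma sqrt_mult_add_le:
  fixes a b c d :: real
  assumes "a \<ge> 0" "b \<ge> 0" "c \<ge> 0" "d \<ge> 0"
  shows "sqrt a * sqrt b + sqrt c * sqrt d \<le> sqrt (a + c) * sqrt (b + d)"
proof -
  have "2 * (sqrt (a * d) * sqrt (b * c)) \<le> a * d + b * c"
    using sum_squares_bound[of "sqrt (a * d)" "sqrt (b * c)"] assms by simp
  then have "(sqrt (a * b) + sqrt (c * d))\<^sup>2 \<le> (a + c) * (b + d)"
    using assms by (simp add: power2_sum power_mult_distrib real_sqrt_mult algebra_simps)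
  then show ?thesis
    unfolding real_sqrt_mult [symmetric] by (rule real_le_rsqrt)
qed

text \<open>Midpoint concavity. Two square roots have total degree 1, the largest degree at which
  such a product is concave; with three factors, \<open>h j = 1\<close> and \<open>k j = 0\<close>
  violate the bound.\<close>

lemma prod_sqrt_add_le:
  fixes h k :: "'i \<Rightarrow> real"
  assumes "finite J" "card J \<le> 2" "\<And>j. h j \<ge> 0" "\<And>j. k j \<ge> 0"
  shows "(\<Prod>j\<in>J. sqrt (h j)) + (\<Prod>j\<in>J. sqrt (k j)) \<le> 2 * (\<Prod>j\<in>J. sqrt ((h j + k j) / 2))"
proof -
  consider "J = {}" | i where "J = {i}" | i j where "J = {i, j}" "i \<noteq> j"
    using assms(1,2) by (metis card_0_eq card_1_singletonE card_2_iff le_SucE le_zero_eq numeral_2_eq_2 One_nat_def)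
  then show ?thesis
  proof cases
    case (2 i)
    have "sqrt (h i) + sqrt (k i) \<le> sqrt (2 * (h i + k i))"
      using sqrt_mult_add_le[of "h i" 1 "k i" 1] assms(3,4) by (simp add: real_sqrt_mult [symmetric] mult.commute)
    also have "\<dots> = 2 * sqrt ((h i + k i) / 2)"
      by (rule power2_eq_imp_eq) (use assms(3,4) in \<open>auto simp: power_mult_distrib\<close>)
    finally show ?thesis by (simp only: 2 prod.insert finite.emptyI empty_iff not_False_eq_True prod.empty mult_1_right)
  next
    case (3 i j)
    then show ?thesis
      using sqrt_mult_add_le[of "h i" "h j" "k i" "k j"] assms(3,4)
      by (simp add: real_sqrt_divide)
  qed simp
qed

lemma bij_betw_perm_compose_left:
  assumes "\<tau> permutes V"
  shows "bij_betw ((\<circ>) \<tau>) {\<pi>. \<pi> permutes V} {\<pi>. \<pi> permutes V}"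
  by (rule bij_betwI[where g = "(\<circ>) (inv \<tau>)"])
    (use assms in \<open>auto simp: permutes_compose permutes_inv fun_eq_iff permutes_inverses\<close>)

text \<open>Each \<pi> is paired with its composition with the transposition. Blocks whose image is
  fixed setwise contribute the same factor to both members of the pair; at most two blocks remain,
  and \<open>prod_sqrt_add_le\<close> handles these.\<close>

lemma perm_sum_average_le:
  fixes V :: "'v set" and D :: "'i \<Rightarrow> 'v set" and h :: "'v set \<Rightarrow> real"
  assumes "finite V" "finite I" "disjoint_family_on D I" "x \<in> V" "y \<in> V" "\<And>S. h S \<ge> 0"
  shows "perm_sum V I D h \<le> perm_sum V I D (\<lambda>S. (h S + h (Transposition.transpose x y ` S)) / 2)"
proof -
  define \<tau> where "\<tau> = Transposition.transpose x y"
  define h' where "h' = (\<lambda>S. (h S + h (\<tau> ` S)) / 2)"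
  define P where "P = (\<lambda>(g :: 'v set \<Rightarrow> real) (\<pi> :: 'v \<Rightarrow> 'v). \<Prod>j\<in>I. sqrt (g (\<pi> ` D j)))"
  have \<tau>: "\<tau> permutes V"
    unfolding \<tau>_def using assms by (intro permutes_swap_id)
  have \<tau>\<tau>: "\<tau> ` \<tau> ` S = S" for S
    by (simp add: \<tau>_def image_comp)
  have avg: "2 * perm_sum V I D g = (\<Sum>\<pi> | \<pi> permutes V. P g \<pi> + P g (\<tau> \<circ> \<pi>))" for g
    using sum.reindex_bij_betw[OF bij_betw_perm_compose_left[OF \<tau>], of "P g"]
    by (simp add: perm_sum_def P_def sum.distrib)
  have "P h \<pi> + P h (\<tau> \<circ> \<pi>) \<le> P h' \<pi> + P h' (\<tau> \<circ> \<pi>)" if "\<pi> permutes V" for \<pi>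
  proof -
    define J where "J = {j \<in> I. \<tau> ` \<pi> ` D j \<noteq> \<pi> ` D j}"
    have "finite J" using assms(2) by (simp add: J_def)
    define a where "a z = {j \<in> I. z \<in> \<pi> ` D j}" for z
    have card_a: "card (a z) \<le> 1" for z
    proof -
      have "i = j" if "i \<in> a z" "j \<in> a z" for i j
      proof (rule ccontr)
        assume "i \<noteq> j"
        then have "D i \<inter> D j = {}"
          using that assms(3) by (auto simp: a_def disjoint_family_on_def)
        then show False
          using that permutes_inj[OF \<open>\<pi> permutes V\<close>] by (auto simp: a_def dest: injD)
      qed
      then show ?thesis
        using assms(2) by (simp add: card_le_Suc0_iff_eq a_def)
    qed
    have "J \<subseteq> a x \<union> a y"
    proof
      fix j assume "j \<in> J"
      then have "j \<in> I" "\<not> (x \<in> \<pi> ` D j \<longleftrightarrow> y \<in> \<pi> ` D j)"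
        unfolding J_def \<tau>_def using transpose_image_eq[of x "\<pi> ` D j" y] by blast+
      then show "j \<in> a x \<union> a y"
        by (auto simp: a_def)
    qed
    then have "card J \<le> card (a x \<union> a y)"
      using assms(2) by (intro card_mono) (auto simp: a_def)
    also have "\<dots> \<le> 2"
      using card_Un_le[of "a x" "a y"] card_a[of x] card_a[of y] by linarith
    finally have "card J \<le> 2" .
    define c where "c = (\<Prod>j\<in>I - J. sqrt (h (\<pi> ` D j)))"
    have split: "P g \<rho> = (\<Prod>j\<in>I - J. sqrt (g (\<rho> ` D j))) * (\<Prod>j\<in>J. sqrt (g (\<rho> ` D j)))" for g \<rho>
      unfolding P_def using assms(2) by (intro prod.subset_diff) (auto simp: J_def)
    have 1: "P h \<pi> = c * (\<Prod>j\<in>J. sqrt (h (\<pi> ` D j)))"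
      by (simp add: split c_def)
    have 2: "P h (\<tau> \<circ> \<pi>) = c * (\<Prod>j\<in>J. sqrt (h (\<tau> ` \<pi> ` D j)))"
    proof -
      have "(\<tau> \<circ> \<pi>) ` D j = \<tau> ` \<pi> ` D j" for j by (rule image_comp [symmetric])
      moreover have "\<tau> ` \<pi> ` D j = \<pi> ` D j" if "j \<in> I - J" for j
        using that by (simp add: J_def)
      ultimately have "(\<Prod>j\<in>I - J. sqrt (h ((\<tau> \<circ> \<pi>) ` D j))) = c"
        unfolding c_def by (intro prod.cong refl) (simp only:)
      then show ?thesis
        unfolding split by (simp only: image_comp)
    qed
    have 3: "P h' \<pi> = c * (\<Prod>j\<in>J. sqrt ((h (\<pi> ` D j) + h (\<tau> ` \<pi> ` D j)) / 2))"
      unfolding split c_def h'_def by (auto simp: J_def intro!: prod.cong arg_cong2[where f = times])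
    \<comment> \<open>The averaged function is invariant, so both members of the pair contribute
      equally; this matches the factor 2 in \<open>prod_sqrt_add_le\<close>.\<close>
    have "h' (\<tau> ` S) = h' S" for S
      by (simp add: h'_def \<tau>\<tau> add.commute)
    then have 4: "P h' (\<tau> \<circ> \<pi>) = P h' \<pi>"
      unfolding P_def image_comp [symmetric] by simp
    have "c \<ge> 0"
      unfolding c_def using assms(6) by (intro prod_nonneg) auto
    then show ?thesis
      unfolding 4 unfolding 1 2 3
      using mult_left_mono[OF prod_sqrt_add_le[OF \<open>finite J\<close> \<open>card J \<le> 2\<close>,
        of "\<lambda>j. h (\<pi> ` D j)" "\<lambda>j. h (\<tau> ` \<pi> ` D j)"] \<open>c \<ge> 0\<close>] assms(6)
      by (simp add: algebra_simps)
  qed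
  then have "2 * perm_sum V I D h \<le> 2 * perm_sum V I D h'"
    unfolding avg by (intro sum_mono) auto
  then show ?thesis by (simp add: h'_def \<tau>_def)
qed

section \<open>Extremal argument reducing to a constant function\<close>

text \<open>Transpositions act transitively on \<open>k\<close>-sets: exchanging a point of
  \<open>S - S'\<close> with one of \<open>S' - S\<close> shrinks the difference.\<close>

lemma eq_if_transpose_invariant:
  fixes g :: "'v set \<Rightarrow> 'c"
  assumes "finite V" and inv: "\<And>x y S. x \<in> V \<Longrightarrow> y \<in> V \<Longrightarrow> S \<subseteq> V \<Longrightarrow> card S = k \<Longrightarrow> g (Transposition.transpose x y ` S) = g S"
    and "S \<subseteq> V" "card S = k" "S' \<subseteq> V" "card S' = k"
  shows "g S = g S'"
  using assms(3,4)
proof (induction "card (S - S')" arbitrary: S rule: less_induct)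
  case (less S)
  have fin: "finite S" "finite S'" using less.prems assms(1,5) finite_subset by blast+
  show ?case
  proof (cases "S = S'")
    case False
    then obtain x where x: "x \<in> S" "x \<notin> S'"
      using fin less.prems(2) assms(6) by (metis card_subset_eq subsetI)
    obtain y where y: "y \<in> S'" "y \<notin> S"
      using False fin less.prems(2) assms(6) by (metis card_subset_eq subsetI)
    have img: "Transposition.transpose x y ` S = insert y (S - {x})"
      using x y by (auto simp: in_transpose_image_iff Transposition.transpose_def)
    have "Transposition.transpose x y ` S \<subseteq> V"
      using y less.prems assms(5) by (auto simp: img)
    moreover have "card (Transposition.transpose x y ` S) = k"
      using less.prems by (simp add: card_image)
    moreover have "card (Transposition.transpose x y ` S - S') < card (S - S')"
      using x y fin by (intro psubset_card_mono) (auto simp: img)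
    ultimately have "g (Transposition.transpose x y ` S) = g S'"
      using less.hyps by blast
    then show ?thesis
      using inv[of x y S] x y less.prems assms(5) by (metis subsetD)
  qed simp
qed

text \<open>Tychonoff's theorem. It supplies the minimiser in the extremal argument, whose functions
  are defined on all sets over a possibly infinite type.\<close>

lemma compact_box_fun:
  fixes M :: real
  shows "compact {g :: 'a \<Rightarrow> real. \<forall>x. 0 \<le> g x \<and> g x \<le> M}"
proof -
  have "compactin (product_topology (\<lambda>_. euclidean) UNIV) (PiE (UNIV :: 'a set) (\<lambda>_. {0..M}))"
    by (simp add: compactin_PiE)
  moreover have "PiE (UNIV :: 'a set) (\<lambda>_. {0..M}) = {g. \<forall>x. 0 \<le> g x \<and> g x \<le> M}"
    by (auto simp: PiE_def Pi_def)
  ultimately show ?thesis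
    by (simp add: euclidean_product_topology)
qed

lemma bij_betw_image_card_subsets:
  assumes "\<tau> permutes V"
  shows "bij_betw ((`) \<tau>) {S. S \<subseteq> V \<and> card S = k} {S. S \<subseteq> V \<and> card S = k}"
proof (rule bij_betwI[where g = "(`) (inv \<tau>)"])
  have *: "\<rho> ` S \<in> {S. S \<subseteq> V \<and> card S = k}" if "\<rho> permutes V" "S \<in> {S. S \<subseteq> V \<and> card S = k}" for \<rho> S
    using that permutes_image[OF that(1)] by (auto simp: card_image permutes_inj_on)
  show "(`) \<tau> \<in> {S. S \<subseteq> V \<and> card S = k} \<rightarrow> {S. S \<subseteq> V \<and> card S = k}"
    "(`) (inv \<tau>) \<in> {S. S \<subseteq> V \<and> card S = k} \<rightarrow> {S. S \<subseteq> V \<and> card S = k}"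
    using *[OF assms] *[OF permutes_inv[OF assms]] by blast+
  show "inv \<tau> ` \<tau> ` S = S" "\<tau> ` inv \<tau> ` S = S" for S
    using assms by (simp_all add: image_comp permutes_inv_o)
qed

text \<open>
  Among the functions on \<open>k\<close>-sets with the same total as \<open>h\<close> and no smaller \<open>perm_sum\<close>, a minimiser
  of the sum of squares is invariant under transpositions, hence constant.
\<close>

lemma perm_sum_le_mean:
  fixes V :: "'v set" and D :: "'i \<Rightarrow> 'v set" and h :: "'v set \<Rightarrow> real"
  assumes "finite V" "finite I" and disj: "disjoint_family_on D I"
    and D: "\<And>j. j \<in> I \<Longrightarrow> D j \<subseteq> V \<and> card (D j) = k"
    and h: "\<And>S. h S \<ge> 0"
  shows "perm_sum V I D h \<le>
    fact (card V) * sqrt ((\<Sum>S | S \<subseteq> V \<and> card S = k. h S) / (card V choose k)) ^ card I"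
proof -
  define \<S> where "\<S> = {S. S \<subseteq> V \<and> card S = k}"
  have "finite \<S>" using assms(1) by (simp add: \<S>_def)
  have card_\<S>: "card \<S> = card V choose k"
    using n_subsets[OF assms(1)] by (simp add: \<S>_def)
  have perm_sum_cong: "perm_sum V I D g = perm_sum V I D g'" if "\<And>S. S \<in> \<S> \<Longrightarrow> g S = g' S" for g g'
  proof -
    have "\<pi> ` D j \<in> \<S>" if "\<pi> permutes V" "j \<in> I" for \<pi> j
      unfolding \<S>_def using D[OF that(2)] by (intro bij_betw_apply[OF bij_betw_image_card_subsets[OF that(1)]]) auto
    then show ?thesis
      unfolding perm_sum_def using that by (intro sum.cong prod.cong) auto
  qed
  define M where "M = (\<Sum>S\<in>\<S>. h S)"
  \<comment> \<open>The bound \<open>M\<close> costs nothing on \<open>k\<close>-sets, since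
    non-negative values with sum \<open>M\<close> are at most \<open>M\<close>; imposing it on all
    sets makes \<open>K\<close> compact.\<close>
  define K where "K = {g. \<forall>S. 0 \<le> g S \<and> g S \<le> M} \<inter>
    ({g. (\<Sum>S\<in>\<S>. g S) = M} \<inter> {g. perm_sum V I D h \<le> perm_sum V I D g})"
  have "M \<ge> 0" unfolding M_def using h by (simp add: sum_nonneg)
  have "closed ({g. (\<Sum>S\<in>\<S>. g S) = M} \<inter> {g. perm_sum V I D h \<le> perm_sum V I D g})"
    unfolding perm_sum_def
    by (intro closed_Int closed_Collect_eq closed_Collect_le continuous_intros continuous_on_product_coordinates)
  then have "compact K"
    unfolding K_def by (intro compact_Int_closed compact_box_fun)
  \<comment> \<open>Off the \<open>k\<close>-sets \<open>h\<close> may exceed \<open>M\<close>, so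
    it is replaced by 0 there; \<open>perm_sum\<close> sees only values on
    \<open>k\<close>-sets.\<close>
  have "(\<lambda>S. if S \<in> \<S> then h S else 0) \<in> K"
  proof -
    have "h S \<le> M" if "S \<in> \<S>" for S
      unfolding M_def using that \<open>finite \<S>\<close> h by (intro member_le_sum) auto
    moreover have "perm_sum V I D h = perm_sum V I D (\<lambda>S. if S \<in> \<S> then h S else 0)"
      by (rule perm_sum_cong) simp
    ultimately show ?thesis
      unfolding K_def using h \<open>M \<ge> 0\<close> by (auto simp: M_def intro!: sum.cong)
  qed
  then have "K \<noteq> {}" by blast
  have "continuous_on K (\<lambda>g. \<Sum>S\<in>\<S>. (g S)\<^sup>2)"
    by (intro continuous_intros continuous_on_subset[OF continuous_on_product_coordinates]) auto
  then obtain g where "g \<in> K" and min: "\<And>g'. g' \<in> K \<Longrightarrow> (\<Sum>S\<in>\<S>. (g S)\<^sup>2) \<le> (\<Sum>S\<in>\<S>. (g' S)\<^sup>2)"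
    using continuous_attains_inf[OF \<open>compact K\<close> \<open>K \<noteq> {}\<close>] by blast
  then have g: "0 \<le> g S" "g S \<le> M" for S by (auto simp: K_def)
  have sum_g: "(\<Sum>S\<in>\<S>. g S) = M" and le_g: "perm_sum V I D h \<le> perm_sum V I D g"
    using \<open>g \<in> K\<close> by (auto simp: K_def)
  have inv: "g (Transposition.transpose x y ` S) = g S" if "x \<in> V" "y \<in> V" "S \<in> \<S>" for x y S
  proof -
    define \<tau> where "\<tau> = Transposition.transpose x y"
    define g' where "g' = (\<lambda>S. (g S + g (\<tau> ` S)) / 2)"
    have "\<tau> permutes V" unfolding \<tau>_def by (intro permutes_swap_id that)
    then have reindex: "(\<Sum>S\<in>\<S>. f (g (\<tau> ` S))) = (\<Sum>S\<in>\<S>. f (g S))" for f :: "real \<Rightarrow> real"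
      unfolding \<S>_def by (intro sum.reindex_bij_betw[where g = "\<lambda>S. f (g S)"] bij_betw_image_card_subsets)
    have "(\<Sum>S\<in>\<S>. g' S) = M"
      using reindex[of "\<lambda>x. x"] sum_g by (simp add: g'_def sum.distrib flip: sum_divide_distrib)
    moreover have "perm_sum V I D g \<le> perm_sum V I D g'"
      unfolding g'_def \<tau>_def using assms(1-3) that g by (intro perm_sum_average_le)
    moreover have "0 \<le> g' S \<and> g' S \<le> M" for S
      using g[of S] g[of "\<tau> ` S"] by (simp add: g'_def)
    ultimately have "g' \<in> K"
      using le_g by (simp add: K_def)
    \<comment> \<open>Parallelogram identity: averaging lowers the sum of squares by a quarter of
      the sum of squared differences, so minimality of \<open>g\<close> forces every difference to
      vanish.\<close>
    have "(g' S)\<^sup>2 = ((g S)\<^sup>2 + (g (\<tau> ` S))\<^sup>2) / 2 - (g S - g (\<tau> ` S))\<^sup>2 / 4" for S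
      by (simp add: g'_def power2_eq_square field_simps)
    then have "(\<Sum>S\<in>\<S>. (g' S)\<^sup>2) = (\<Sum>S\<in>\<S>. (g S)\<^sup>2) - (\<Sum>S\<in>\<S>. (g S - g (\<tau> ` S))\<^sup>2) / 4"
      using reindex[of "\<lambda>x. x\<^sup>2"]
      by (simp add: sum_subtractf sum.distrib flip: sum_divide_distrib)
    with min[OF \<open>g' \<in> K\<close>] have "(\<Sum>S\<in>\<S>. (g S - g (\<tau> ` S))\<^sup>2) \<le> 0" by simp
    then have "(\<Sum>S\<in>\<S>. (g S - g (\<tau> ` S))\<^sup>2) = 0"
      by (intro antisym sum_nonneg) auto
    then show ?thesis
      using \<open>S \<in> \<S>\<close> \<open>finite \<S>\<close> by (simp add: sum_nonneg_eq_0_iff \<tau>_def)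
  qed
  have const: "g S = M / card \<S>" if "S \<in> \<S>" for S
  proof -
    have "g S' = g S" if "S' \<in> \<S>" for S'
      using eq_if_transpose_invariant[OF assms(1), of k g S' S] inv that \<open>S \<in> \<S>\<close> by (auto simp: \<S>_def)
    then have "M = card \<S> * g S" using sum_g by simp
    moreover have "card \<S> \<noteq> 0" using that \<open>finite \<S>\<close> by auto
    ultimately show ?thesis by simp
  qed
  have "perm_sum V I D g = perm_sum V I D (\<lambda>_. M / card \<S>)"
    by (rule perm_sum_cong) (simp add: const)
  also have "\<dots> = fact (card V) * sqrt (M / card \<S>) ^ card I"
    by (simp add: perm_sum_def card_permutations[OF refl assms(1)])
  finally show ?thesis
    using le_g unfolding M_def card_\<S> by (simp add: \<S>_def)
qed

section \<open>Chernoff bounds for random partitions\<close>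

text \<open>The left side is the moment generating function at \<open>u\<close> of a Bernoulli
  variable of mean \<beta>; the range of \<open>u\<close> permits
  \<open>exp u \<le> 1 + u + u\<^sup>2\<close>.\<close>

lemma exp_mixture_le:
  fixes \<beta> u :: real
  assumes "0 \<le> u" "u \<le> 1" "0 \<le> \<beta>" "\<beta> \<le> 1"
  shows "1 + \<beta> * (exp u - 1) \<le> exp (\<beta> * u + u\<^sup>2)"
proof -
  have "1 + \<beta> * (exp u - 1) \<le> exp (\<beta> * (exp u - 1))" by (rule exp_ge_add_one_self)
  also have "\<beta> * (exp u - 1) \<le> \<beta> * (u + u\<^sup>2)"
    using exp_bound[OF assms(1,2)] assms(3) by (intro mult_left_mono) auto
  also have "\<dots> \<le> \<beta> * u + u\<^sup>2"
    using mult_right_mono[OF assms(4), of "u\<^sup>2"] by (simp add: algebra_simps)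
  finally show ?thesis by simp
qed

text \<open>Exponential Markov inequality. Per block, the moment is at most
  \<open>exp (\<epsilon> * \<beta> + 2 * \<epsilon>\<^sup>2)\<close> and the threshold contributes
  \<open>exp (\<epsilon> * (\<beta> + 4 * \<epsilon>))\<close>; the quotient is
  \<open>exp (- 2 * \<epsilon>\<^sup>2)\<close>. The deviation \<open>4 * \<epsilon>\<close> is the
  one for which \<epsilon> is the best parameter in this estimate.\<close>

lemma perm_upper_tail:
  fixes V :: "'v set" and D :: "'i \<Rightarrow> 'v set" and \<beta> \<epsilon> :: real
  assumes "finite V" "finite I" "disjoint_family_on D I"
    and "\<And>j. j \<in> I \<Longrightarrow> D j \<subseteq> V \<and> card (D j) = k"
    and "k \<le> card V" and \<beta>: "0 \<le> \<beta>" "\<beta> \<le> 1" and \<epsilon>: "0 \<le> \<epsilon>" "\<epsilon> \<le> 1 / 2"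
    and bad: "card {S. S \<subseteq> V \<and> card S = k \<and> P S} \<le> \<beta> * (card V choose k)"
  shows "card {\<pi>. \<pi> permutes V \<and> card {j \<in> I. P (\<pi> ` D j)} \<ge> (\<beta> + 4 * \<epsilon>) * card I}
    \<le> exp (- 2 * \<epsilon>\<^sup>2 * card I) * fact (card V)"
proof -
  define \<S> where "\<S> = {S. S \<subseteq> V \<and> card S = k}"
  define m N where "m = card I" and "N = card V choose k"
  have "finite \<S>" using assms(1) by (simp add: \<S>_def)
  have card_\<S>: "card \<S> = N"
    using n_subsets[OF assms(1)] by (simp add: \<S>_def N_def)
  have "N > 0" using assms(5) by (simp add: N_def)
  define h where "h S = exp (2 * \<epsilon> * of_bool (P S))" for S
  define T where "T = {\<pi>. \<pi> permutes V \<and> card {j \<in> I. P (\<pi> ` D j)} \<ge> (\<beta> + 4 * \<epsilon>) * m}"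
  have "finite T" unfolding T_def using finite_permutations[OF assms(1)] by auto
  have prod_h: "(\<Prod>j\<in>I. sqrt (h (\<pi> ` D j))) = exp (\<epsilon> * card {j \<in> I. P (\<pi> ` D j)})" for \<pi>
  proof -
    have "sqrt (h S) = exp (\<epsilon> * of_bool (P S))" for S
      by (rule real_sqrt_unique) (simp_all add: h_def flip: exp_of_nat_mult)
    then have "(\<Prod>j\<in>I. sqrt (h (\<pi> ` D j))) = exp (\<Sum>j\<in>I. \<epsilon> * of_bool (P (\<pi> ` D j)))"
      by (simp only: exp_sum[OF assms(2)])
    also have "(\<Sum>j\<in>I. \<epsilon> * of_bool (P (\<pi> ` D j))) = \<epsilon> * card {j \<in> I. P (\<pi> ` D j)}"
      using assms(2) by (simp add: Int_def flip: sum_distrib_left)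
    finally show ?thesis .
  qed
  have "card T * exp (\<epsilon> * ((\<beta> + 4 * \<epsilon>) * m)) \<le> (\<Sum>\<pi>\<in>T. \<Prod>j\<in>I. sqrt (h (\<pi> ` D j)))"
    unfolding prod_h using \<epsilon> by (intro sum_bounded_below) (auto simp: T_def intro!: mult_left_mono)
  also have "\<dots> \<le> perm_sum V I D h"
    unfolding perm_sum_def using finite_permutations[OF assms(1)]
    by (intro sum_mono2) (auto simp: T_def h_def intro!: prod_nonneg)
  also have "\<dots> \<le> fact (card V) * sqrt ((\<Sum>S\<in>\<S>. h S) / N) ^ m"
    unfolding m_def \<S>_def N_def using assms(1-5) by (intro perm_sum_le_mean) (auto simp: h_def)
  also have "(\<Sum>S\<in>\<S>. h S) = (\<Sum>S\<in>\<S>. 1 + (exp (2 * \<epsilon>) - 1) * of_bool (P S))"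
    by (intro sum.cong) (auto simp: h_def)
  also have "\<dots> = N + (exp (2 * \<epsilon>) - 1) * card {S \<in> \<S>. P S}"
    using \<open>finite \<S>\<close> by (simp add: sum.distrib card_\<S> Int_def flip: sum_distrib_left)
  also have "\<dots> / N = 1 + (card {S \<in> \<S>. P S} / N) * (exp (2 * \<epsilon>) - 1)"
    using \<open>N > 0\<close> by (simp add: field_simps)
  also have "fact (card V) * sqrt \<dots> ^ m \<le> fact (card V) * exp (\<epsilon> * \<beta> + 2 * \<epsilon>\<^sup>2) ^ m"
  proof (intro mult_left_mono power_mono)
    have "card {S \<in> \<S>. P S} / N \<le> \<beta>"
      using bad \<open>N > 0\<close> by (simp add: \<S>_def N_def field_simps)
    then have "1 + (card {S \<in> \<S>. P S} / N) * (exp (2 * \<epsilon>) - 1) \<le> 1 + \<beta> * (exp (2 * \<epsilon>) - 1)"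
      using \<epsilon> by (intro add_left_mono mult_right_mono) auto
    also have "\<dots> \<le> exp (\<beta> * (2 * \<epsilon>) + (2 * \<epsilon>)\<^sup>2)"
      using \<beta> \<epsilon> by (intro exp_mixture_le) auto
    also have "\<dots> = (exp (\<epsilon> * \<beta> + 2 * \<epsilon>\<^sup>2))\<^sup>2"
      by (simp add: field_simps flip: exp_of_nat_mult)
    finally show "sqrt (1 + (card {S \<in> \<S>. P S} / N) * (exp (2 * \<epsilon>) - 1)) \<le> exp (\<epsilon> * \<beta> + 2 * \<epsilon>\<^sup>2)"
      by (simp add: real_le_lsqrt)
  qed (use \<epsilon> in auto)
  also have "\<dots> = (exp (- 2 * \<epsilon>\<^sup>2 * m) * fact (card V)) * exp (\<epsilon> * ((\<beta> + 4 * \<epsilon>) * m))"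
    by (simp add: algebra_simps power2_eq_square flip: exp_of_nat_mult exp_add)
  finally show ?thesis
    unfolding T_def m_def by simp
qed

text \<open>The upper tail for the complementary property with
  \<open>\<beta> = 1 - \<alpha> - 4 * \<epsilon>\<close>, whose threshold is
  \<open>1 - \<alpha>\<close>. The event is non-strict, so outside it the count strictly exceeds
  \<open>\<alpha> * card I\<close>.\<close>

lemma perm_lower_tail:
  fixes V :: "'v set" and D :: "'i \<Rightarrow> 'v set" and \<alpha> \<epsilon> :: real
  assumes "finite V" "finite I" "disjoint_family_on D I"
    and "\<And>j. j \<in> I \<Longrightarrow> D j \<subseteq> V \<and> card (D j) = k"
    and "k \<le> card V" and "0 \<le> \<alpha>" "0 \<le> \<epsilon>" "\<epsilon> \<le> 1 / 2"
    and good: "card {S. S \<subseteq> V \<and> card S = k \<and> P S} \<ge> (\<alpha> + 4 * \<epsilon>) * (card V choose k)"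
  shows "card {\<pi>. \<pi> permutes V \<and> card {j \<in> I. P (\<pi> ` D j)} \<le> \<alpha> * card I}
    \<le> exp (- 2 * \<epsilon>\<^sup>2 * card I) * fact (card V)"
proof -
  define \<S> where "\<S> = {S. S \<subseteq> V \<and> card S = k}"
  have "finite \<S>" using assms(1) by (simp add: \<S>_def)
  have card_\<S>: "card \<S> = card V choose k"
    using n_subsets[OF assms(1)] by (simp add: \<S>_def)
  have pos: "card V choose k > 0" using assms(5) by simp
  have compl: "card {x \<in> A. \<not> Q x} = real (card A) - card {x \<in> A. Q x}" if "finite A" for A :: "'x set" and Q
  proof -
    have "card A = card ({x \<in> A. Q x} \<union> {x \<in> A. \<not> Q x})" by (rule arg_cong[where f = card]) auto
    also have "\<dots> = card {x \<in> A. Q x} + card {x \<in> A. \<not> Q x}"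
      using that by (intro card_Un_disjoint) auto
    finally show ?thesis by simp
  qed
  \<comment> \<open>Comparing \<open>good\<close> with the number of all \<open>k\<close>-sets gives
    \<open>\<alpha> + 4 * \<epsilon> \<le> 1\<close>, so the \<beta> of the complement is
    non-negative.\<close>
  have "card {S \<in> \<S>. P S} \<le> card \<S>" using \<open>finite \<S>\<close> by (intro card_mono) auto
  then have "(\<alpha> + 4 * \<epsilon>) * (card V choose k) \<le> 1 * real (card V choose k)"
    using good by (simp add: \<S>_def card_\<S>[unfolded \<S>_def])
  then have le1: "\<alpha> + 4 * \<epsilon> \<le> 1" using pos by (subst (asm) mult_le_cancel_right_pos) auto
  have "card {S. S \<subseteq> V \<and> card S = k \<and> \<not> P S} \<le> (1 - \<alpha> - 4 * \<epsilon>) * (card V choose k)"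
    using good compl[OF \<open>finite \<S>\<close>, of P] by (simp add: card_\<S>[unfolded \<S>_def] \<S>_def algebra_simps)
  then have "card {\<pi>. \<pi> permutes V \<and> card {j \<in> I. \<not> P (\<pi> ` D j)} \<ge> (1 - \<alpha> - 4 * \<epsilon> + 4 * \<epsilon>) * card I}
    \<le> exp (- 2 * \<epsilon>\<^sup>2 * card I) * fact (card V)"
    using assms le1 by (intro perm_upper_tail[where k = k]) auto
  also have "{\<pi>. \<pi> permutes V \<and> card {j \<in> I. \<not> P (\<pi> ` D j)} \<ge> (1 - \<alpha> - 4 * \<epsilon> + 4 * \<epsilon>) * card I} =
    {\<pi>. \<pi> permutes V \<and> card {j \<in> I. P (\<pi> ` D j)} \<le> \<alpha> * card I}"
    by (simp add: compl[OF assms(2)] algebra_simps)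
  finally show ?thesis .
qed

lemma ex_equipartition:
  assumes "finite V" "card V = k * n"
  shows "\<exists>D :: nat \<Rightarrow> 'v set. disjoint_family_on D {..<n} \<and> (\<forall>j<n. card (D j) = k) \<and> (\<Union>j<n. D j) = V"
  using assms
proof (induction n arbitrary: V)
  case 0
  then show ?case by (auto simp: disjoint_family_on_def)
next
  case (Suc n)
  obtain B where B: "B \<subseteq> V" "card B = k" "finite B"
    using obtain_subset_with_card_n[of k V] Suc.prems by auto
  then have "card (V - B) = k * n"
    using Suc.prems by (simp add: card_Diff_subset)
  then obtain D where D: "disjoint_family_on D {..<n}" "\<forall>j<n. card (D j) = k" "(\<Union>j<n. D j) = V - B"
    using Suc.IH[of "V - B"] Suc.prems by auto
  have "disjoint_family_on (D(n := B)) {..<Suc n}"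
    using D(1,3) by (fastforce simp: disjoint_family_on_def less_Suc_eq)
  moreover have "\<forall>j<Suc n. card ((D(n := B)) j) = k"
    using D(2) B by (simp add: less_Suc_eq)
  moreover have "(\<Union>j<Suc n. (D(n := B)) j) = V"
    using D(3) B(1) by (auto simp: lessThan_Suc)
  ultimately show ?case by blast
qed

subsection \<open>Random blocks of the hypergraph\<close>

lemma bipartite_family_commute: "bipartite_family V1 V2 a b = bipartite_family V2 V1 b a"
  by (auto simp: bipartite_family_def)

text \<open>An edge has exactly \<open>a\<close> points in \<open>V1\<close>, so one containing
  \<open>S\<close> meets \<open>V1\<close> in \<open>S\<close> alone and is determined by its trace
  on \<open>V2\<close>.\<close>

lemma hdeg_eq_card_link:
  assumes "H \<subseteq> bipartite_family V1 V2 a b" "finite V1" "V1 \<inter> V2 = {}" "S \<subseteq> V1" "card S = a"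
  shows "hdeg H S = card {T. T \<subseteq> V2 \<and> card T = b \<and> S \<union> T \<in> H}"
proof -
  let ?L = "{T. T \<subseteq> V2 \<and> card T = b \<and> S \<union> T \<in> H}"
  have "{e \<in> H. S \<subseteq> e} = (\<union>) S ` ?L"
  proof (intro equalityI subsetI)
    fix e assume e: "e \<in> {e \<in> H. S \<subseteq> e}"
    then have "e \<subseteq> V1 \<union> V2" "card (e \<inter> V1) = a" "card (e \<inter> V2) = b"
      using assms(1) by (auto simp: bipartite_family_def)
    moreover from this have "e \<inter> V1 = S"
      using card_subset_eq[of "e \<inter> V1" S] e assms(2,4,5) by auto
    ultimately have "e = S \<union> (e \<inter> V2)" "card (e \<inter> V2) = b" by auto
    then show "e \<in> (\<union>) S ` ?L"
      using e by (intro image_eqI[of _ _ "e \<inter> V2"]) auto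
  qed auto
  moreover have "inj_on ((\<union>) S) ?L"
    by (rule inj_on_inverseI[where g = "\<lambda>e. e \<inter> V2"]) (use assms(3,4) in auto)
  ultimately show ?thesis
    by (simp add: hdeg_def card_image)
qed

lemma min_deg_le_hdeg:
  assumes "finite V" "S \<subseteq> V" "card S = k"
  shows "min_deg H V k \<le> hdeg H S"
  unfolding min_deg_def using assms by (intro Min_le) auto

text \<open>Union bound for independent uniform \<open>x\<close> and \<open>y\<close>:
  \<open>P\<close> is rare over \<open>y\<close> for each fixed \<open>x\<close>, \<open>Q\<close>
  is rare over \<open>x\<close> for each fixed \<open>y\<close>, and there are
  \<open>2 * card I\<close> events of probability at most \<open>c\<close>.\<close>

lemma ex_pair_avoiding:
  fixes P Q :: "'i \<Rightarrow> 'a \<Rightarrow> 'b \<Rightarrow> bool" and c :: real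
  assumes fin: "finite X" "finite Y" "finite I" and "X \<noteq> {}" "Y \<noteq> {}"
    and P: "\<And>x i. x \<in> X \<Longrightarrow> i \<in> I \<Longrightarrow> card {y \<in> Y. P i x y} \<le> c * card Y"
    and Q: "\<And>y i. y \<in> Y \<Longrightarrow> i \<in> I \<Longrightarrow> card {x \<in> X. Q i x y} \<le> c * card X"
    and c: "2 * card I * c < 1"
  shows "\<exists>x\<in>X. \<exists>y\<in>Y. \<forall>i\<in>I. \<not> P i x y \<and> \<not> Q i x y"
proof (rule ccontr)
  assume "\<not> ?thesis"
  then have contr: "\<exists>i\<in>I. P i x y \<or> Q i x y" if "x \<in> X" "y \<in> Y" for x y
    using that by simp
  define p q where "p i x y = (of_bool (P i x y) :: real)" and "q i x y = (of_bool (Q i x y) :: real)" for i x y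
  have nonneg: "p i x y \<ge> 0" "q i x y \<ge> 0" for i x y by (simp_all add: p_def q_def)
  have sum_p: "(\<Sum>y\<in>Y. p i x y) = card {y \<in> Y. P i x y}" for i x
    using fin by (simp add: p_def Int_def)
  have sum_q: "(\<Sum>x\<in>X. q i x y) = card {x \<in> X. Q i x y}" for i y
    using fin by (simp add: q_def Int_def)
  have "1 \<le> (\<Sum>i\<in>I. p i x y) + (\<Sum>i\<in>I. q i x y)" if "x \<in> X" "y \<in> Y" for x y
  proof -
    from contr[OF that] obtain i where "i \<in> I" "P i x y \<or> Q i x y" by blast
    then have "1 \<le> p i x y + q i x y" by (auto simp: p_def q_def)
    also have "\<dots> \<le> (\<Sum>i\<in>I. p i x y) + (\<Sum>i\<in>I. q i x y)"
      using \<open>i \<in> I\<close> fin nonneg by (intro add_mono member_le_sum) auto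
    finally show ?thesis .
  qed
  then have "(\<Sum>x\<in>X. \<Sum>y\<in>Y. 1) \<le> (\<Sum>x\<in>X. \<Sum>y\<in>Y. (\<Sum>i\<in>I. p i x y) + (\<Sum>i\<in>I. q i x y))"
    by (intro sum_mono)
  \<comment> \<open>The two halves are summed in different orders, so that the innermost variable is
    the one over which \<open>P\<close>, respectively \<open>Q\<close>, is known to be rare.\<close>
  also have "\<dots> = (\<Sum>i\<in>I. \<Sum>x\<in>X. \<Sum>y\<in>Y. p i x y) + (\<Sum>i\<in>I. \<Sum>y\<in>Y. \<Sum>x\<in>X. q i x y)"
    by (simp add: sum.distrib sum.swap[of _ I] sum.swap[of _ X Y])
  also have "\<dots> \<le> (\<Sum>i\<in>I. \<Sum>x\<in>X. c * card Y) + (\<Sum>i\<in>I. \<Sum>y\<in>Y. c * card X)"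
    unfolding sum_p sum_q using P Q by (intro add_mono sum_mono)
  also have "\<dots> = (2 * card I * c) * (card X * card Y)"
    by (simp add: algebra_simps)
  also have "\<dots> < 1 * real (card X * card Y)"
    using assms by (intro mult_strict_right_mono) (auto simp: card_gt_0_iff)
  finally show False by simp
qed

theorem theorem1p3:
  fixes V1 V2 :: "'v set" and H :: "'v set set" and n a b :: nat
  assumes "n \<ge> 5" and "a \<ge> 1" and "b \<ge> 1"
    and "finite V1" and "finite V2" and "V1 \<inter> V2 = {}"
    and "card V1 = a * n" and "card V2 = b * n"
    and "H \<subseteq> bipartite_family V1 V2 a b"
    and "\<exists>\<alpha>::real. 0 < \<alpha> \<and> \<alpha> < 1 \<and>
           real (min_deg H V1 a) \<ge> (\<alpha> + 4 * sqrt (ln (real n) / real n)) * real ((b * n) choose b) \<and>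
           real (min_deg H V2 b) \<ge> (1 - \<alpha> + 4 * sqrt (ln (real n) / real n)) * real ((a * n) choose a)"
  shows "has_hamilton_ab_cycle H (V1 \<union> V2) a b"
proof -
  define \<epsilon> where "\<epsilon> = sqrt (ln n / n)"
  obtain \<alpha> :: real where \<alpha>: "0 < \<alpha>" "\<alpha> < 1"
    and deg1: "min_deg H V1 a \<ge> (\<alpha> + 4 * \<epsilon>) * (card V2 choose b)"
    and deg2: "min_deg H V2 b \<ge> (1 - \<alpha> + 4 * \<epsilon>) * (card V1 choose a)"
    using assms(7,8,10) by (auto simp: \<epsilon>_def)
  have "\<epsilon> \<ge> 0" and \<epsilon>_sq: "\<epsilon>\<^sup>2 = ln n / n"
    using \<open>n \<ge> 5\<close> by (auto simp: \<epsilon>_def)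
  have link1: "(\<alpha> + 4 * \<epsilon>) * (card V2 choose b) \<le> card {T. T \<subseteq> V2 \<and> card T = b \<and> S \<union> T \<in> H}"
    if "S \<subseteq> V1" "card S = a" for S
    using deg1 min_deg_le_hdeg[OF assms(4) that, of H] hdeg_eq_card_link[OF assms(9,4,6) that] by linarith
  have link2: "(1 - \<alpha> + 4 * \<epsilon>) * (card V1 choose a) \<le> card {T. T \<subseteq> V1 \<and> card T = a \<and> T \<union> S \<in> H}"
    if "S \<subseteq> V2" "card S = b" for S
    using deg2 min_deg_le_hdeg[OF assms(5) that, of H]
      hdeg_eq_card_link[OF assms(9)[unfolded bipartite_family_commute[of V1]] assms(5) _ that]
      assms(6) by (simp add: Un_commute Int_commute)
  obtain C where C: "disjoint_family_on C {..<n}" "\<And>j. j < n \<Longrightarrow> card (C j) = a" "(\<Union>j<n. C j) = V1"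
    using ex_equipartition[OF assms(4,7)] by blast
  obtain D where D: "disjoint_family_on D {..<n}" "\<And>j. j < n \<Longrightarrow> card (D j) = b" "(\<Union>j<n. D j) = V2"
    using ex_equipartition[OF assms(5,8)] by blast
  have C_sub: "C j \<subseteq> V1" and D_sub: "D j \<subseteq> V2" if "j < n" for j
    using that C(3) D(3) by auto
  have "a \<le> card V1" "b \<le> card V2" using assms(1,7,8) by auto
  \<comment> \<open>The link of a single block cannot exceed the number of all
    \<open>b\<close>-subsets of \<open>V2\<close>, so the degree hypothesis itself limits
    \<epsilon>.\<close>
  have "\<epsilon> \<le> 1 / 2"
  proof -
    have "(\<alpha> + 4 * \<epsilon>) * (card V2 choose b) \<le> card {T. T \<subseteq> V2 \<and> card T = b \<and> C 0 \<union> T \<in> H}"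
      using assms(1) C(2) C_sub by (intro link1) auto
    also have "\<dots> \<le> card {T. T \<subseteq> V2 \<and> card T = b}"
      using assms(5) by (intro of_nat_mono card_mono) auto
    also have "\<dots> = 1 * real (card V2 choose b)" using n_subsets[OF assms(5)] by simp
    finally have "\<alpha> + 4 * \<epsilon> \<le> 1"
      using \<open>b \<le> card V2\<close> by (subst (asm) mult_le_cancel_right_pos) auto
    then show ?thesis using \<alpha> by simp
  qed
  \<comment> \<open>Since \<open>n * \<epsilon>\<^sup>2 = ln n\<close>, each tail probability is at
    most \<open>1 / n\<^sup>2\<close>; the \<open>2 * n\<close> bad events then have total
    probability at most \<open>2 / n < 1\<close>.\<close>
  have exp_eq: "exp (- 2 * \<epsilon>\<^sup>2 * card {..<n}) = 1 / n\<^sup>2"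
  proof -
    have "exp (- 2 * \<epsilon>\<^sup>2 * card {..<n}) = exp (- ln (n\<^sup>2))"
      using \<open>n \<ge> 5\<close> by (simp add: \<epsilon>_sq ln_realpow)
    also have "\<dots> = 1 / n\<^sup>2" using \<open>n \<ge> 5\<close> by (simp add: exp_minus inverse_eq_divide)
    finally show ?thesis .
  qed
  let ?X = "{\<pi>. \<pi> permutes V1}" and ?Y = "{\<sigma>. \<sigma> permutes V2}"
  \<comment> \<open>The bad events: a block of \<open>V1\<close> (\<open>?P\<close>) or of
    \<open>V2\<close> (\<open>?Q\<close>) has too small a degree in the block graph.\<close>
  let ?P = "\<lambda>i \<pi> \<sigma>. card {j \<in> {..<n}. \<pi> ` C i \<union> \<sigma> ` D j \<in> H} \<le> \<alpha> * n"
  let ?Q = "\<lambda>j \<pi> \<sigma>. card {i \<in> {..<n}. \<pi> ` C i \<union> \<sigma> ` D j \<in> H} \<le> (1 - \<alpha>) * n"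
  have "\<exists>\<pi>\<in>?X. \<exists>\<sigma>\<in>?Y. \<forall>i\<in>{..<n}. \<not> ?P i \<pi> \<sigma> \<and> \<not> ?Q i \<pi> \<sigma>"
  proof (rule ex_pair_avoiding[where c = "1 / n\<^sup>2"])
    fix \<pi> i assume "\<pi> \<in> ?X" "i \<in> {..<n}"
    then have *: "\<pi> ` C i \<subseteq> V1" "card (\<pi> ` C i) = a"
      using C_sub[of i] C(2)[of i] permutes_image[of \<pi> V1] by (auto simp: card_image permutes_inj_on)
    \<comment> \<open>With \<pi> fixed, the block of \<open>V1\<close> is one fixed
      \<open>a\<close>-set with a large link, so only \<sigma> is random and the lower tail applies
      to that link.\<close>
    have "card {\<sigma>. \<sigma> permutes V2 \<and> card {j \<in> {..<n}. \<pi> ` C i \<union> \<sigma> ` D j \<in> H} \<le> \<alpha> * card {..<n}}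
      \<le> exp (- 2 * \<epsilon>\<^sup>2 * card {..<n}) * fact (card V2)"
      using assms(5) D D_sub \<open>b \<le> card V2\<close> \<alpha> \<open>\<epsilon> \<ge> 0\<close> \<open>\<epsilon> \<le> 1 / 2\<close> link1[OF *]
      by (intro perm_lower_tail[where k = b]) auto
    then show "card {\<sigma> \<in> ?Y. ?P i \<pi> \<sigma>} \<le> 1 / n\<^sup>2 * card ?Y"
      unfolding exp_eq by (simp add: card_permutations[OF refl assms(5)])
  next
    fix \<sigma> j assume "\<sigma> \<in> ?Y" "j \<in> {..<n}"
    then have *: "\<sigma> ` D j \<subseteq> V2" "card (\<sigma> ` D j) = b"
      using D_sub[of j] D(2)[of j] permutes_image[of \<sigma> V2] by (auto simp: card_image permutes_inj_on)
    have "card {\<pi>. \<pi> permutes V1 \<and> card {i \<in> {..<n}. \<pi> ` C i \<union> \<sigma> ` D j \<in> H} \<le> (1 - \<alpha>) * card {..<n}}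
      \<le> exp (- 2 * \<epsilon>\<^sup>2 * card {..<n}) * fact (card V1)"
      using assms(4) C C_sub \<open>a \<le> card V1\<close> \<alpha> \<open>\<epsilon> \<ge> 0\<close> \<open>\<epsilon> \<le> 1 / 2\<close> link2[OF *]
      by (intro perm_lower_tail[where k = a]) auto
    then show "card {\<pi> \<in> ?X. ?Q j \<pi> \<sigma>} \<le> 1 / n\<^sup>2 * card ?X"
      unfolding exp_eq by (simp add: card_permutations[OF refl assms(4)])
  next
    show "2 * card {..<n} * (1 / n\<^sup>2) < 1"
      using \<open>n \<ge> 5\<close> by (simp add: power2_eq_square field_simps)
  qed (use assms(4,5) in \<open>auto intro: finite_permutations permutes_id\<close>)
  then obtain \<pi> \<sigma> where \<pi>: "\<pi> permutes V1" and \<sigma>: "\<sigma> permutes V2"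
    and P: "\<And>i. i < n \<Longrightarrow> \<alpha> * n < card {j \<in> {..<n}. \<pi> ` C i \<union> \<sigma> ` D j \<in> H}"
    and Q: "\<And>j. j < n \<Longrightarrow> (1 - \<alpha>) * n < card {i \<in> {..<n}. \<pi> ` C i \<union> \<sigma> ` D j \<in> H}"
    by (auto simp: not_le)
  \<comment> \<open>The block graph lives on indices; the strict lower bounds
    \<open>\<alpha> * n\<close> and \<open>(1 - \<alpha>) * n\<close> make every degree sum across
    the two sides exceed \<open>n\<close>.\<close>
  have "\<exists>u v. bij_betw u {..<n} {..<n} \<and> bij_betw v {..<n} {..<n} \<and>
      ham_cycle n (\<lambda>i j. \<pi> ` C i \<union> \<sigma> ` D j \<in> H) u v"
  proof (rule moon_moser)
    fix i j assume "i \<in> {..<n}" "j \<in> {..<n}"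
    then have "real n < card {j \<in> {..<n}. \<pi> ` C i \<union> \<sigma> ` D j \<in> H} + card {i \<in> {..<n}. \<pi> ` C i \<union> \<sigma> ` D j \<in> H}"
      using P[of i] Q[of j] by (simp add: algebra_simps)
    then show "n < card {j \<in> {..<n}. \<pi> ` C i \<union> \<sigma> ` D j \<in> H} + card {i \<in> {..<n}. \<pi> ` C i \<union> \<sigma> ` D j \<in> H}"
      by linarith
  qed (use \<open>n \<ge> 5\<close> in auto)
  then obtain u v where u: "bij_betw u {..<n} {..<n}" and v: "bij_betw v {..<n} {..<n}"
    and ham: "ham_cycle n (\<lambda>i j. \<pi> ` C i \<union> \<sigma> ` D j \<in> H) u v" by blast
  have u_lt: "u i < n" and v_lt: "v i < n" if "i < n" for i
    using that bij_betw_apply[OF u] bij_betw_apply[OF v] by auto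
  \<comment> \<open>The blocks are relisted in the order in which the Hamilton cycle visits
    them.\<close>
  define A B where "A i = \<pi> ` C (u i)" and "B i = \<sigma> ` D (v i)" for i
  have A_Un: "(\<Union>i<n. A i) = V1"
  proof -
    have "(\<Union>i<n. A i) = \<pi> ` (\<Union>j\<in>u ` {..<n}. C j)" by (auto simp: A_def)
    also have "u ` {..<n} = {..<n}" using u by (simp add: bij_betw_def)
    finally show ?thesis unfolding C(3) permutes_image[OF \<pi>] .
  qed
  have B_Un: "(\<Union>i<n. B i) = V2"
  proof -
    have "(\<Union>i<n. B i) = \<sigma> ` (\<Union>j\<in>v ` {..<n}. D j)" by (auto simp: B_def)
    also have "v ` {..<n} = {..<n}" using v by (simp add: bij_betw_def)
    finally show ?thesis unfolding D(3) permutes_image[OF \<sigma>] .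
  qed
  have "A i \<inter> A j = {}" "B i \<inter> B j = {}" if "i < n" "j < n" "i \<noteq> j" for i j
  proof -
    have "u i \<noteq> u j" "v i \<noteq> v j"
      using that u v by (auto simp: bij_betw_def inj_on_def)
    then have "C (u i) \<inter> C (u j) = {}" "D (v i) \<inter> D (v j) = {}"
      using C(1) D(1) that u_lt v_lt by (auto simp: disjoint_family_on_def)
    then show "A i \<inter> A j = {}" "B i \<inter> B j = {}"
      unfolding A_def B_def
      using permutes_inj[OF \<pi>] permutes_inj[OF \<sigma>] by (simp_all flip: image_Int)
  qed
  moreover have "card (A i) = a" "card (B i) = b" if "i < n" for i
    using that C(2) D(2) u_lt v_lt \<pi> \<sigma> by (simp_all add: A_def B_def card_image permutes_inj_on)
  moreover have "A i \<inter> B j = {}" if "i < n" "j < n" for i j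
    using that A_Un B_Un assms(6) by blast
  moreover have "(\<Union>i<n. A i \<union> B i) = V1 \<union> V2"
    unfolding A_Un [symmetric] B_Un [symmetric] by blast
  moreover have "A i \<union> B i \<in> H" "B i \<union> A ((i + 1) mod n) \<in> H" if "i < n" for i
    using ham that by (auto simp: ham_cycle_def A_def B_def Un_commute)
  ultimately show ?thesis
    unfolding has_hamilton_ab_cycle_def using \<open>n \<ge> 5\<close>
    by (intro exI[of _ n] exI[of _ A] exI[of _ B]) auto
qed

end
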